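(* For all $n\ge0$, $$F_n=\sum_{j=0}^{n}\binom{n}{j}B_j\,\widetilde F_{n-j};$$ equivalently, as formal power series, $F(x)=B(x)\,\widetilde F(x)$, where $F(x)=\sum_{n\ge0}F_n\frac{x^n}{n!}$, $B(x)=\sum_{n\ge0}B_n\frac{x^n}{n!}$ and $\widetilde F(x)=\sum_{n\ge0}\widetilde F_n\frac{x^n}{n!}$.
   Context: $S(n,k)$ is the Stirling number of the second kind and $d_k$ is the number of derangements of $\{1,\dots,k\}$ ($d_0=1$). $F_n=\sum_{k=0}^n k!\,S(n,k)$ is the Fubini number (the number of ordered set partitions of $[n]=\{1,\dots,n\}$). $B_n$ is the Bell number (number of set partitions of $[n]$). $\widetilde F_n=\sum_{k=0}^n d_kS(n,k)$ is the deranged Bell number, i.e. the number of deranged ordered set partitions of $[n]$: those $(C_1,\dots,C_k)$ such that, if $B_1,\dots,B_k$ are the same blocks listed by increasing minimum element, then $C_i\neq B_i$ for all $i$. *)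

theory Defs
  imports
    "HOL-Combinatorics.Stirling"
    "HOL-Combinatorics.Permutations"
    "HOL-Library.Disjoint_Sets"
    "HOL-Computational_Algebra.Formal_Power_Series"
begin

(* At k = 0 the identity vacuously has no fixed point in {1..0}, so the value is 1. *)
definition derangement_number :: "nat \<Rightarrow> nat" where
  "derangement_number k = card {p. p permutes {1..k} \<and> (\<forall>i\<in>{1..k}. p i \<noteq> i)}"

definition fubini_number :: "nat \<Rightarrow> nat" where
  "fubini_number n = (\<Sum>k=0..n. fact k * Stirling n k)"

definition bell_number :: "nat \<Rightarrow> nat" where
  "bell_number n = card {P. partition_on {1..n} P}"

(* Choosing k blocks and then a fixed-point-free rearrangement of them (relative to the
   order by increasing minimum) gives the deranged ordered set partitions of {1..n}. *)
definition deranged_bell_number :: "nat \<Rightarrow> nat" where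
  "deranged_bell_number n = (\<Sum>k=0..n. derangement_number k * Stirling n k)"

definition egf :: "(nat \<Rightarrow> nat) \<Rightarrow> rat fps" where
  "egf a = Abs_fps (\<lambda>n. of_nat (a n) / fact n)"

end

(* Writing E = exp x - 1, the powers of E are the generating functions of the Stirling
   numbers, so the Stirling transform n |-> sum_k a_k S(n,k) corresponds to composing the
   exponential generating function of a with E. Sorting the permutations by their set of
   fixed points gives 1/(1-x) = exp x * D(x), with D the generating function of the
   derangement numbers; composing with E, which is multiplicative, gives F = exp(E) * F~.
   Finally exp(E) = B, since both solve y' = y * exp x, y(0) = 1; for B the differential
   equation expresses the choice of the block that contains a given point. *)
theory Submission
  imports Defs
begin

unbundle fps_syntax

section \<open>Exponential generating functions\<close>

lemma egf_nth: "egf a $ n = of_nat (a n) / fact n"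
  by (simp add: egf_def)

lemma egf_eq_iff: "egf a = egf b \<longleftrightarrow> (\<forall>n. a n = b n)"
  by (auto simp: fps_eq_iff egf_nth)

lemma egf_mult: "egf a * egf b = egf (\<lambda>n. \<Sum>j=0..n. (n choose j) * a j * b (n - j))"
proof (rule fps_ext)
  fix n
  have "of_nat (a j) / fact j * (of_nat (b (n - j)) / fact (n - j)) =
          (of_nat ((n choose j) * a j * b (n - j)) / fact n :: rat)" if "j \<in> {0..n}" for j
    using that by (simp add: binomial_fact)
  then show "(egf a * egf b) $ n = egf (\<lambda>n. \<Sum>j=0..n. (n choose j) * a j * b (n - j)) $ n"
    unfolding fps_mult_nth egf_nth of_nat_sum sum_divide_distrib by (rule sum.cong[OF refl])
qed

lemma egf_one: "egf (\<lambda>_. 1) = fps_exp 1"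
  by (rule fps_ext) (simp add: egf_nth)

lemma fps_deriv_egf: "fps_deriv (egf a) = egf (\<lambda>n. a (Suc n))"
  by (rule fps_ext) (simp add: egf_nth fps_deriv_nth divide_simps del: of_nat_Suc)

text \<open>Turns a sum over subsets into a binomial sum. It serves both counts below: by the set of
  fixed points and by the block of a distinguished point.\<close>

lemma sum_Pow_card:
  assumes "finite A"
  shows "(\<Sum>X\<in>Pow A. h (card X)) = (\<Sum>j=0..card A. (card A choose j) * h j)"
proof -
  have "(\<Sum>X\<in>Pow A. h (card X)) =
          (\<Sum>j=0..card A. \<Sum>X\<in>{X \<in> Pow A. card X = j}. h (card X))"
    using assms by (intro sum.group[symmetric]) (auto intro: card_mono)
  also have "\<dots> = (\<Sum>j=0..card A. (card A choose j) * h j)"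
    by (intro sum.cong) (simp_all add: n_subsets assms)
  finally show ?thesis .
qed

section \<open>Stirling numbers\<close>

text \<open>With E = exp x - 1 we have E' = E + 1, so the derivative of E^k is k (E^k + E^(k-1)).
  Comparing coefficients reproduces the recurrence of the Stirling numbers.\<close>

lemma Stirling_egf: "(fps_exp 1 - 1) ^ k $ n = (fact k * of_nat (Stirling n k) / fact n :: rat)"
proof (induction n arbitrary: k)
  case 0
  then show ?case by (cases k) simp_all
next
  case (Suc n)
  show ?case
  proof (cases k)
    case 0
    then show ?thesis by simp
  next
    case k: (Suc m)
    let ?E = "fps_exp 1 - 1 :: rat fps"
    have "fps_deriv (?E ^ k) = of_nat k * (?E ^ k + ?E ^ m)"
      unfolding fps_deriv_power' by (simp add: k algebra_simps)
    then have "fps_deriv (?E ^ k) $ n = of_nat k * (?E ^ k $ n + ?E ^ m $ n)"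
      by (simp flip: fps_of_nat)
    then have "of_nat (Suc n) * ?E ^ k $ Suc n = of_nat k * (?E ^ k $ n + ?E ^ m $ n)"
      by (simp add: fps_deriv_nth)
    also have "\<dots> = fact k * of_nat (Stirling (Suc n) k) / fact n"
      unfolding Suc.IH by (simp add: k field_simps)
    finally show ?thesis
      by (simp add: field_simps del: of_nat_Suc)
  qed
qed

text \<open>The \<open>fact k\<close> in \<open>Stirling_egf\<close> cancels the denominator of the
  k-th coefficient of \<open>egf a\<close>.\<close>

lemma egf_Stirling_transform:
  "egf (\<lambda>n. \<Sum>k=0..n. a k * Stirling n k) = egf a oo (fps_exp 1 - 1)"
  by (rule fps_ext) (simp add: egf_nth fps_compose_nth Stirling_egf sum_divide_distrib)

section \<open>Derangements\<close>

text \<open>Conjugation by a bijection carries derangements to derangements.\<close>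

lemma card_derangements:
  assumes "finite A"
  shows "card {p. p permutes A \<and> (\<forall>x\<in>A. p x \<noteq> x)} = derangement_number (card A)"
proof -
  obtain f where "bij_betw f A {1..card A}"
    using assms by (metis ex_bij_betw_nat_finite_1 bij_betw_inv)
  from bij_betw_same_card[OF bij_betw_derangements[OF this]] show ?thesis
    by (simp add: derangement_number_def)
qed

text \<open>A permutation also permutes the set of points that it moves; conversely, a permutation
  of \<open>A - X\<close> fixes every point of \<open>X\<close>.\<close>

lemma permutes_fixing_iff:
  "p permutes A \<and> {x \<in> A. p x = x} = X \<longleftrightarrow>
     X \<subseteq> A \<and> p permutes (A - X) \<and> (\<forall>x\<in>A - X. p x \<noteq> x)"
proof safe
  assume "p permutes A"
  then show "p permutes (A - {x \<in> A. p x = x})"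
    by (rule permutes_superset) auto
next
  assume "p permutes (A - X)"
  then show "p permutes A"
    by (rule permutes_subset) auto
qed (auto simp: permutes_not_in)

lemma fact_eq_sum_derangement_number:
  "fact n = (\<Sum>j=0..n. (n choose j) * derangement_number (n - j))"
proof -
  define A where "A = {1..n}"
  have A: "finite A" "card A = n"
    by (simp_all add: A_def)
  have "fact n = card {p. p permutes A}"
    using A by (simp add: card_permutations)
  \<comment> \<open>Group the permutations by their set \<open>X\<close> of fixed points.\<close>
  also have "\<dots> = (\<Sum>X\<in>Pow A. card {p \<in> {p. p permutes A}. {x \<in> A. p x = x} = X})"
    unfolding card_eq_sum using A(1)
    by (intro sum.group[symmetric]) (auto simp: finite_permutations)
  also have "\<dots> = (\<Sum>X\<in>Pow A. derangement_number (n - card X))"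
  proof (intro sum.cong refl)
    fix X assume "X \<in> Pow A"
    then have "finite (A - X)" "card (A - X) = n - card X"
      using A by (auto simp: card_Diff_subset finite_subset)
    from card_derangements[OF this(1)] this(2)
    have "card {p. p permutes (A - X) \<and> (\<forall>x\<in>A - X. p x \<noteq> x)} = derangement_number (n - card X)"
      by simp
    moreover have "{p \<in> {p. p permutes A}. {x \<in> A. p x = x} = X} =
        {p. p permutes (A - X) \<and> (\<forall>x\<in>A - X. p x \<noteq> x)}"
      using \<open>X \<in> Pow A\<close> by (simp add: permutes_fixing_iff)
    ultimately show "card {p \<in> {p. p permutes A}. {x \<in> A. p x = x} = X} =
        derangement_number (n - card X)"
      by simp
  qed
  finally show ?thesis
    using sum_Pow_card[OF A(1), of "\<lambda>j. derangement_number (n - j)"] A by simp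
qed

lemma egf_fact: "egf fact = fps_exp 1 * egf derangement_number"
  unfolding egf_one[symmetric] egf_mult egf_eq_iff
  by (simp add: fact_eq_sum_derangement_number)

section \<open>Bell numbers\<close>

lemma card_partition_on:
  assumes "finite A"
  shows "card {P. partition_on A P} = bell_number (card A)"
proof -
  \<comment> \<open>Mapping partitions blockwise is injective, which gives an inequality; applying
    it to a bijection and to its inverse gives equality.\<close>
  have le: "card {P. partition_on B P} \<le> card {P. partition_on C P}"
    if "finite C" and f: "bij_betw f B C" for f :: "'b \<Rightarrow> 'c" and B C
  proof (rule card_inj_on_le)
    show "finite {P. partition_on C P}"
      using that by (simp add: finitely_many_partition_on)
    have inj: "inj_on f B" and im: "f ` B = C"
      using f by (auto simp: bij_betw_def)
    show "(`) ((`) f) ` {P. partition_on B P} \<subseteq> {P. partition_on C P}"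
    proof clarify
      fix P assume P: "partition_on B P"
      \<comment> \<open>\<open>partition_on_inj_image\<close> removes an empty image, but no block
        of \<open>P\<close> is empty.\<close>
      then have "(`) f ` P - {{}} = (`) f ` P"
        by (auto simp: partition_on_def)
      with partition_on_inj_image[OF P inj] im show "partition_on C ((`) f ` P)"
        by simp
    qed
    have "inj_on ((`) ((`) f)) (Pow (Pow B))"
      using inj by (intro inj_on_image_Pow)
    then show "inj_on ((`) ((`) f)) {P. partition_on B P}"
      by (rule inj_on_subset) (auto simp: partition_on_def)
  qed
  obtain f where f: "bij_betw f A {1..card A}"
    using assms by (metis ex_bij_betw_nat_finite_1 bij_betw_inv)
  show ?thesis
    unfolding bell_number_def
    using le[OF _ f] le[OF assms bij_betw_inv_into[OF f]] by (intro antisym) auto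
qed

text \<open>The block of the extra point \<open>a\<close> is \<open>insert a X\<close> for a subset
  \<open>X\<close> of the other points; deleting it leaves a partition of
  \<open>A - X\<close>.\<close>

lemma bell_number_Suc: "bell_number (Suc n) = (\<Sum>j=0..n. (n choose j) * bell_number (n - j))"
proof -
  define A where "A = {1..n}"
  define a where "a = Suc n"
  have A: "finite A" "card A = n" "a \<notin> A"
    by (simp_all add: A_def a_def)
  let ?S = "SIGMA X:Pow A. {P. partition_on (A - X) P}"
  let ?f = "\<lambda>(X, P). insert (insert a X) P"
  have split: "disjnt (insert a X) (\<Union>P)" if "(X, P) \<in> ?S" for X P
    using that A(3) by (auto simp: partition_on_def disjnt_iff)
  have "bij_betw ?f ?S {P. partition_on (insert a A) P}"
    unfolding bij_betw_def
  proof (intro conjI subset_antisym subsetI)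
    show "inj_on ?f ?S"
    proof (rule inj_onI, clarify)
      fix X P Y Q
      assume *: "X \<subseteq> A" "Y \<subseteq> A" "partition_on (A - X) P" "partition_on (A - Y) Q"
        and eq: "insert (insert a X) P = insert (insert a Y) Q"
      \<comment> \<open>The added block is the only one containing \<open>a\<close>, so the image
        determines first \<open>X\<close> and then \<open>P\<close>.\<close>
      have notin: "B \<notin> P" "B \<notin> Q" if "a \<in> B" for B
        using that *(3,4) A(3) by (auto simp: partition_on_def)
      have "insert a X = insert a Y"
        using eq notin by (metis insertI1 insertE)
      then have "X = Y"
        using *(1,2) A(3) by (metis insert_ident subsetD)
      moreover have "P = Q"
        using eq notin[of "insert a Y"] \<open>X = Y\<close> by (simp add: insert_ident)
      ultimately show "X = Y \<and> P = Q" by simp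
    qed
  next
    fix Q assume "Q \<in> ?f ` ?S"
    then obtain X P where XP: "(X, P) \<in> ?S" and Q: "Q = insert (insert a X) P"
      by auto
    moreover have "insert a A - insert a X = A - X"
      using A(3) by auto
    ultimately show "Q \<in> {P. partition_on (insert a A) P}"
      using partition_on_insert[OF split[OF XP], of "insert a A"] by auto
  next
    fix Q assume "Q \<in> {P. partition_on (insert a A) P}"
    then have Q: "partition_on (insert a A) Q"
      by simp
    \<comment> \<open>The preimage of \<open>Q\<close> is read off from the block \<open>B\<close>
      of \<open>a\<close>.\<close>
    then obtain B where B: "B \<in> Q" "a \<in> B"
      by (metis UnionE insertI1 partition_onD1)
    have sub: "B \<subseteq> insert a A"
      using B Q by (auto simp: partition_on_def)
    have "disjnt B (\<Union>(Q - {B}))"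
      using B Q by (auto simp: partition_on_def pairwise_def disjnt_iff)
    from partition_on_insert[OF this, of "insert a A"] Q B
    have "partition_on (insert a A - B) (Q - {B})"
      by (simp add: insert_absorb)
    moreover have "insert a A - B = A - (B - {a})" "insert a (B - {a}) = B"
      using B A(3) by auto
    ultimately show "Q \<in> ?f ` ?S"
      using B sub by (intro image_eqI[of _ _ "(B - {a}, Q - {B})"]) (auto simp: insert_absorb)
  qed
  then have "card {P. partition_on (insert a A) P} = card ?S"
    by (metis bij_betw_same_card)
  also have "\<dots> = (\<Sum>X\<in>Pow A. card {P. partition_on (A - X) P})"
    using A by (intro card_SigmaI) (auto intro: finitely_many_partition_on)
  also have "\<dots> = (\<Sum>X\<in>Pow A. bell_number (n - card X))"
    using A by (intro sum.cong) (auto simp: card_partition_on card_Diff_subset finite_subset)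
  finally show ?thesis
    using sum_Pow_card[OF A(1), of "\<lambda>j. bell_number (n - j)"] A by (simp add: card_partition_on)
qed

lemma bell_number_0: "bell_number 0 = 1"
  by (simp add: bell_number_def partition_on_empty)

text \<open>The equation expresses \<open>Suc m\<close> times coefficient \<open>Suc m\<close>
  through the coefficients up to \<open>m\<close>; in characteristic 0 the factor
  \<open>Suc m\<close> cancels.\<close>

lemma fps_linear_ODE_unique:
  fixes f g h :: "'a :: field_char_0 fps"
  assumes "fps_deriv f = f * h" and "fps_deriv g = g * h" and "f $ 0 = g $ 0"
  shows "f = g"
proof (rule fps_ext)
  fix n
  show "f $ n = g $ n"
  proof (induction n rule: less_induct)
    case (less n)
    show ?case
    proof (cases n)
      case 0
      then show ?thesis using assms(3) by simp
    next
      case (Suc m)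
      have "(f * h) $ m = (g * h) $ m"
        unfolding fps_mult_nth using less Suc by (intro sum.cong) auto
      then have "of_nat (Suc m) * f $ Suc m = of_nat (Suc m) * g $ Suc m"
        unfolding assms(1,2)[symmetric] by (simp add: fps_deriv_nth)
      then show ?thesis
        using Suc by (simp del: of_nat_Suc)
    qed
  qed
qed

lemma egf_bell_number: "egf bell_number = fps_exp 1 oo (fps_exp 1 - 1)"
proof (rule fps_linear_ODE_unique[where h = "fps_exp 1"])
  show "fps_deriv (egf bell_number) = egf bell_number * fps_exp 1"
    \<comment> \<open>With the exponential as first factor, \<open>egf_mult\<close> yields the sum
      of \<open>bell_number_Suc\<close>.\<close>
    unfolding mult.commute[of "egf bell_number"]
    unfolding fps_deriv_egf egf_one[symmetric] egf_mult by (simp add: bell_number_Suc)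
  show "fps_deriv (fps_exp 1 oo (fps_exp 1 - 1)) = (fps_exp 1 oo (fps_exp 1 - 1)) * fps_exp (1::rat)"
    by (simp add: fps_compose_deriv)
qed (simp add: egf_nth bell_number_0)

theorem theorem4p7:
  shows "(\<forall>n::nat. fubini_number n =
            (\<Sum>j=0..n. (n choose j) * bell_number j * deranged_bell_number (n - j)))
         \<and> egf fubini_number = egf bell_number * egf deranged_bell_number"
proof -
  let ?E = "fps_exp 1 - 1 :: rat fps"
  have "egf fubini_number = egf fact oo ?E"
    unfolding egf_Stirling_transform[symmetric] egf_eq_iff by (simp add: fubini_number_def)
  \<comment> \<open>Composition with \<open>?E\<close> respects products because its constant term
    is zero.\<close>
  also have "\<dots> = (fps_exp 1 oo ?E) * (egf derangement_number oo ?E)"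
    by (simp add: egf_fact fps_compose_mult_distrib)
  also have "egf derangement_number oo ?E = egf deranged_bell_number"
    unfolding egf_Stirling_transform[symmetric] egf_eq_iff by (simp add: deranged_bell_number_def)
  finally have "egf fubini_number = egf bell_number * egf deranged_bell_number"
    by (simp add: egf_bell_number)
  then show ?thesis
    by (simp add: egf_mult egf_eq_iff)
qed

end
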